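(* Let $\Lambda=\{1,\dots,N\}$, $n=\sum_{i\in\Lambda}n_i$, let $\mathcal X$ be a non-empty closed convex subset of $\mathbb R^n=\prod_{i\in\Lambda}\mathbb R^{n_i}$, let $X_i$ be the projection of $\mathcal X$ on $\mathbb R^{n_i}$, and let $X=\prod_{i\in\Lambda}X_i$. Let $K_i:X\rightrightarrows X_i$ be given by $K_i(x)=\{z_i\in X_i\mid(x_{-i},z_i)\in\mathcal X\}$. Suppose that (a) for each $i\in\Lambda$, the multi-valued map $P_i:X\rightrightarrows X_i$ is lower semi-continuous with open upper sections and satisfies $x_i\notin co(P_i(x))$ for every $x\in X$; (b) there exists $\rho>0$ such that for each $x\in\mathcal X\setminus\bar B(0,\rho)$ there exists $z\in\mathcal X$ with $\|z\|<\|x\|$ and $z_i\in P_i(x)$ for each $i\in\Lambda$; (c) there exists $\rho'>\rho$ such that $\mathcal X\cap\bar B(0,\rho')\ne\emptyset$. Then there exists an equilibrium for the game $\Gamma'=(\mathcal X,K_i,P_i)_{i\in\Lambda}$.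
   Context: Notation: $x=(x_i)_{i\in\Lambda}=(x_{-i},x_i)$, where $x_{-i}$ collects the components of all players except $i$; $co$ denotes convex hull; $\|\cdot\|$ is the Euclidean norm and $\bar B(0,r)$ the closed ball of radius $r$ centred at $0$ in $\mathbb R^n$. Values of multi-valued maps may be empty. Open upper sections: $P_i$ has open upper sections if $P_i(x)$ is open (as a subset of $\mathbb R^{n_i}$) for every $x\in X$. Equilibrium: $\tilde x\in X$ is an equilibrium (solution) for $\Gamma'$ if, for each $i\in\Lambda$, $\tilde x_i\in K_i(\tilde x)$ and $P_i(\tilde x)\cap K_i(\tilde x)=\emptyset$. *)

theory Defs
  imports "HOL-Analysis.Analysis"
begin

text \<open>
  The players form a finite type \<open>'l\<close>, and the product of the spaces \<open>R^{n_i}\<close> is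
  \<open>real ^ 'n\<close>, where \<open>own :: 'n \<Rightarrow> 'l\<close> says to which player each coordinate belongs, so that
  \<open>n_i = card {j. own j = i}\<close>.  Since the block sizes may differ, \<open>R^{n_i}\<close> cannot be a type
  depending on \<open>i\<close>; it is identified with the coordinate subspace of vectors vanishing outside
  the block of player \<open>i\<close>, and a point of \<open>R^{n_i}\<close> is a vector in that subspace.
\<close>

definition block_space :: "('n::finite \<Rightarrow> 'l) \<Rightarrow> 'l \<Rightarrow> (real ^ 'n) set" where
  "block_space own i = {v. \<forall>j. own j \<noteq> i \<longrightarrow> v $ j = 0}"

text \<open>The component \<open>x_i\<close> of \<open>x\<close>, and the point \<open>(x_{-i}, z_i)\<close>.\<close>

definition block :: "('n::finite \<Rightarrow> 'l) \<Rightarrow> 'l \<Rightarrow> real ^ 'n \<Rightarrow> real ^ 'n" where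
  "block own i x = (\<chi> j. if own j = i then x $ j else 0)"

definition replace_block ::
    "('n::finite \<Rightarrow> 'l) \<Rightarrow> 'l \<Rightarrow> real ^ 'n \<Rightarrow> real ^ 'n \<Rightarrow> real ^ 'n" where
  "replace_block own i x z = (\<chi> j. if own j = i then z $ j else x $ j)"

definition strategy_set :: "('n::finite \<Rightarrow> 'l) \<Rightarrow> (real ^ 'n) set \<Rightarrow> 'l \<Rightarrow> (real ^ 'n) set" where
  "strategy_set own \<X> i = block own i ` \<X>"

definition strategy_profiles :: "('n::finite \<Rightarrow> 'l) \<Rightarrow> (real ^ 'n) set \<Rightarrow> (real ^ 'n) set" where
  "strategy_profiles own \<X> = {x. \<forall>i. block own i x \<in> strategy_set own \<X> i}"

definition constraint_map ::
    "('n::finite \<Rightarrow> 'l) \<Rightarrow> (real ^ 'n) set \<Rightarrow> 'l \<Rightarrow> real ^ 'n \<Rightarrow> (real ^ 'n) set" where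
  "constraint_map own \<X> i x = {z \<in> strategy_set own \<X> i. replace_block own i x z \<in> \<X>}"

text \<open>Multi-valued maps are set-valued functions; their values may be empty.\<close>

definition lower_semicontinuous_map_on ::
    "'a::topological_space set \<Rightarrow> ('a \<Rightarrow> 'b::topological_space set) \<Rightarrow> bool" where
  "lower_semicontinuous_map_on S F \<longleftrightarrow>
     (\<forall>x\<in>S. \<forall>V. open V \<and> F x \<inter> V \<noteq> {} \<longrightarrow>
        (\<exists>U. open U \<and> x \<in> U \<and> (\<forall>y\<in>U \<inter> S. F y \<inter> V \<noteq> {})))"

definition open_upper_sections_on ::
    "'b::topological_space set \<Rightarrow> 'a set \<Rightarrow> ('a \<Rightarrow> 'b set) \<Rightarrow> bool" where
  "open_upper_sections_on E S F \<longleftrightarrow> (\<forall>x\<in>S. openin (top_of_set E) (F x))"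

definition is_equilibrium ::
    "('n::finite \<Rightarrow> 'l) \<Rightarrow> (real ^ 'n) set \<Rightarrow> ('l \<Rightarrow> real ^ 'n \<Rightarrow> (real ^ 'n) set) \<Rightarrow>
     ('l \<Rightarrow> real ^ 'n \<Rightarrow> (real ^ 'n) set) \<Rightarrow> real ^ 'n \<Rightarrow> bool" where
  "is_equilibrium own \<X> K P x \<longleftrightarrow>
     x \<in> strategy_profiles own \<X> \<and> (\<forall>i. block own i x \<in> K i x \<and> P i x \<inter> K i x = {})"

end

theory Submission
  imports Defs
begin

text \<open>
  Let \<open>M x\<close> be the set of vectors each of whose blocks \<open>m_i\<close> is a unit vector with
  \<open>m_i \<bullet> (z - x_i) \<ge> 0\<close> for all \<open>z \<in> P_i(x)\<close>. It is non-empty by separation, lower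
  semicontinuity of \<open>P_i\<close> makes its graph closed, and openness of \<open>P_i(x)\<close> makes the
  inequalities strict, a property that survives in \<open>co (M x)\<close>. On the compact set
  \<open>C = \<X> \<inter> cball 0 \<rho>'\<close> there are \<open>x\<close> and \<open>w \<in> co (M x)\<close> with \<open>w \<bullet> (y - x) \<le> 0\<close> for all
  \<open>y \<in> C\<close>. If \<open>\<parallel>x\<parallel> = \<rho>'\<close>, the point \<open>z\<close> of (b) lies in \<open>C\<close> and satisfies
  \<open>w \<bullet> (z - x) > 0\<close>, which is impossible; so \<open>\<parallel>x\<parallel> < \<rho>'\<close>, and the inequality extends to all
  of \<open>\<X>\<close> along segments. A point \<open>z \<in> P_i(x) \<inter> K_i(x)\<close> would violate it at
  \<open>y = (x_{-i}, z)\<close>.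
\<close>

section \<open>Fixed points of multi-valued maps with open lower sections\<close>

text \<open>Unless one point lies in all values, a partition of unity subordinate to finitely many
  lower sections of \<open>F\<close> gives a continuous selection, to which Brouwer's theorem
  applies.\<close>

lemma browder_fixed_point:
  fixes C :: "'a::euclidean_space set"
  assumes "compact C" "convex C" "C \<noteq> {}"
    and sub: "\<And>x. x \<in> C \<Longrightarrow> F x \<subseteq> C"
    and ne: "\<And>x. x \<in> C \<Longrightarrow> F x \<noteq> {}"
    and conv: "\<And>x. x \<in> C \<Longrightarrow> convex (F x)"
    and lower: "\<And>y. y \<in> C \<Longrightarrow> openin (top_of_set C) {x \<in> C. y \<in> F x}"
  obtains x where "x \<in> C" "x \<in> F x"
proof (cases "\<exists>y\<in>C. \<forall>x\<in>C. y \<in> F x")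
  case True
  then show ?thesis using that by blast
next
  case False
  \<comment> \<open>No \<open>B y\<close> with \<open>y \<in> C\<close> is empty in this case. This
    matters because \<open>infdist\<close> to the empty set is 0; now, for \<open>x \<in> C\<close>,
    \<open>infdist x (B y)\<close> is positive exactly when \<open>y \<in> F x\<close>.\<close>
  define B where "B y = C - {x \<in> C. y \<in> F x}" for y
  have B: "closed (B y)" "B y \<noteq> {}" if "y \<in> C" for y
  proof -
    have "closedin (top_of_set C) (B y)"
      unfolding B_def using lower[OF that] by (metis closedin_diff closedin_topspace topspace_euclidean_subtopology)
    then show "closed (B y)" using \<open>compact C\<close> closedin_closed_eq compact_imp_closed by blast
    show "B y \<noteq> {}" using False that by (auto simp: B_def)
  qed
  have "C \<subseteq> (\<Union>y\<in>C. - B y)" using ne sub by (fastforce simp: B_def)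
  then obtain Y where Y: "Y \<subseteq> C" "finite Y" "C \<subseteq> (\<Union>y\<in>Y. - B y)"
    using compactE_image[OF \<open>compact C\<close>, of C "\<lambda>y. - B y"] B by (metis open_Compl)
  define s where "s x = (\<Sum>y\<in>Y. infdist x (B y))" for x
  have pos: "infdist x (B y) > 0 \<longleftrightarrow> x \<notin> B y" if "y \<in> Y" for x y
    using B[of y] that Y(1) infdist_pos_not_in_closed[of "B y" x] by auto
  have s_pos: "s x > 0" if "x \<in> C" for x
    using that Y(3) pos unfolding s_def
    by (metis (mono_tags, lifting) ComplD UN_E Y(2) infdist_nonneg subsetD sum_pos2)
  \<comment> \<open>For \<open>x \<in> C\<close>, only points \<open>y \<in> F x\<close> get
    positive weight, so convexity puts \<open>f x\<close> into \<open>F x\<close>.\<close>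
  define f where "f x = (\<Sum>y\<in>Y. (infdist x (B y) / s x) *\<^sub>R y)" for x
  have f: "f x \<in> convex hull {y \<in> Y. x \<notin> B y}" if "x \<in> C" for x
  proof -
    let ?Z = "{y \<in> Y. x \<notin> B y}"
    have *: "infdist x (B y) = 0" if "y \<in> Y - ?Z" for y
      using that by auto
    have "f x = (\<Sum>y\<in>?Z. (infdist x (B y) / s x) *\<^sub>R y)"
      unfolding f_def using * Y(2) by (intro sum.mono_neutral_right) auto
    moreover have "(\<Sum>y\<in>?Z. infdist x (B y)) = s x"
      unfolding s_def using * Y(2) by (intro sum.mono_neutral_left) auto
    then have "(\<Sum>y\<in>?Z. infdist x (B y) / s x) = 1"
      using s_pos[OF that] by (simp flip: sum_divide_distrib)
    moreover have "(\<Sum>y\<in>?Z. (infdist x (B y) / s x) *\<^sub>R y) \<in> convex hull ?Z"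
      using calculation(2) s_pos[OF that] Y(2)
      by (intro convex_sum convex_convex_hull) (simp_all add: hull_inc infdist_nonneg)
    ultimately show ?thesis by simp
  qed
  have F: "f x \<in> F x" if "x \<in> C" for x
    using hull_minimal[of "{y \<in> Y. x \<notin> B y}" "F x" convex] f[OF that] conv[OF that] that
    by (auto simp: B_def)
  have "continuous_on C s" unfolding s_def by (intro continuous_intros)
  then have "continuous_on C f" unfolding f_def
    using s_pos by (intro continuous_intros) force+
  moreover have "f \<in> C \<rightarrow> C" using F sub by blast
  ultimately obtain x where "x \<in> C" "f x = x"
    using brouwer assms(1-3) by blast
  then show ?thesis using F that by metis
qed

section \<open>Polar cones and uniform directions\<close>

text \<open>If \<open>a\<close> were outside the closed convex cone, a separating functional
  \<open>d\<close> would be bounded below on the cone, hence non-negative there; then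
  \<open>- d\<close> is polar to \<open>S\<close> but positive at \<open>a\<close>.\<close>

lemma mem_closure_cone_hull_bipolar:
  fixes S :: "'a::euclidean_space set"
  assumes "convex S" "S \<noteq> {}"
    and polar: "\<And>d. (\<And>s. s \<in> S \<Longrightarrow> d \<bullet> s \<le> 0) \<Longrightarrow> d \<bullet> a \<le> 0"
  shows "a \<in> closure (cone hull S)"
proof (rule ccontr)
  assume "a \<notin> closure (cone hull S)"
  then obtain d b where d: "d \<bullet> a < b" "\<And>q. q \<in> closure (cone hull S) \<Longrightarrow> d \<bullet> q > b"
    using separating_hyperplane_closed_point[of "closure (cone hull S)" a] assms(1)
    by (metis closed_closure convex_closure convex_cone_hull)
  have cone: "d \<bullet> (c *\<^sub>R s) > b" if "s \<in> S" "c \<ge> 0" for c s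
    using d(2) that by (meson closure_subset mem_cone_hull subsetD)
  have "b < 0" using cone[of _ 0] assms(2) by fastforce
  have "d \<bullet> s \<ge> 0" if "s \<in> S" for s
  proof (rule ccontr)
    assume "\<not> ?thesis"
    \<comment> \<open>Both \<open>b\<close> and \<open>d \<bullet> s\<close> are negative, so this
      is a legitimate multiple of \<open>s\<close>, and \<open>d\<close> takes exactly the excluded
      value \<open>b\<close> on it.\<close>
    then show False using cone[OF that, of "b / (d \<bullet> s)"] \<open>b < 0\<close>
      by (simp add: divide_nonpos_nonpos)
  qed
  then have "- d \<bullet> a \<le> 0" by (intro polar) auto
  then show False using d(1) \<open>b < 0\<close> by simp
qed

text \<open>
  A minimax statement: \<open>T\<close> is separated from the polar cone of \<open>S\<close>, and the separating vector
  lies in the closed cone generated by \<open>S\<close>.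
\<close>

lemma polar_disjoint_imp_uniform_direction:
  fixes S T :: "'a::euclidean_space set"
  assumes "convex S" "S \<noteq> {}" "convex T" "compact T" "T \<noteq> {}"
    and ex: "\<And>w. w \<in> T \<Longrightarrow> \<exists>s\<in>S. w \<bullet> s > 0"
  obtains s where "s \<in> S" "\<And>w. w \<in> T \<Longrightarrow> w \<bullet> s > 0"
proof -
  define D where "D = {d. \<forall>s\<in>S. d \<bullet> s \<le> 0}"
  have D_eq: "D = (\<Inter>s\<in>S. {d. s \<bullet> d \<le> 0})" by (auto simp: D_def inner_commute)
  have "convex D" "closed D" unfolding D_eq
    by (auto intro!: convex_INT convex_halfspace_le closed_INT closed_halfspace_le)
  moreover have "T \<inter> D = {}" using ex by (force simp: D_def)
  ultimately obtain a b where ab: "\<And>d. d \<in> D \<Longrightarrow> a \<bullet> d < b" "\<And>w. w \<in> T \<Longrightarrow> a \<bullet> w > b"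
    using separating_hyperplane_closed_compact[of D T] assms(3-5) by (metis Int_commute)
  have "b > 0" using ab(1)[of 0] by (simp add: D_def)
  have "a \<in> closure (cone hull S)"
  proof (rule mem_closure_cone_hull_bipolar[OF assms(1,2)])
    fix d assume d: "\<And>s. s \<in> S \<Longrightarrow> d \<bullet> s \<le> 0"
    show "d \<bullet> a \<le> 0"
    proof (rule ccontr)
      assume *: "\<not> ?thesis"
      \<comment> \<open>This multiple of \<open>d\<close> stays in the cone \<open>D\<close>, and
        \<open>a\<close> takes the value \<open>b\<close> on it, contrary to the separation.\<close>
      have "(b / (d \<bullet> a)) *\<^sub>R d \<in> D"
        using d * \<open>b > 0\<close> by (auto simp: D_def intro!: divide_nonpos_pos mult_nonneg_nonpos)
      from ab(1)[OF this] * show False by (simp add: inner_commute)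
    qed
  qed
  moreover obtain R where R: "R > 0" "\<And>w. w \<in> T \<Longrightarrow> norm w \<le> R"
    using compact_imp_bounded[OF assms(4)] by (auto simp: bounded_pos)
  \<comment> \<open>The tolerance \<open>b / R\<close> keeps the change of
    \<open>w \<bullet> a\<close> below \<open>b\<close> on all of \<open>T\<close>, so
    \<open>w \<bullet> q\<close> stays positive.\<close>
  ultimately obtain q where q: "q \<in> cone hull S" "dist q a < b / R"
    using \<open>b > 0\<close> by (metis closure_approachable divide_pos_pos)
  then obtain c s where s: "q = c *\<^sub>R s" "c \<ge> 0" "s \<in> S" by (auto simp: cone_hull_expl)
  have "w \<bullet> s > 0" if "w \<in> T" for w
  proof -
    have "\<bar>w \<bullet> (a - q)\<bar> \<le> norm w * norm (a - q)" by (rule Cauchy_Schwarz_ineq2)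
    also have "\<dots> \<le> R * norm (a - q)" using R(2)[OF that] by (simp add: mult_right_mono)
    also have "\<dots> < b" using q(2) R(1) by (simp add: dist_norm norm_minus_commute field_simps)
    finally have "c * (w \<bullet> s) > 0"
      using ab(2)[OF that] s(1) by (simp add: inner_diff_right inner_commute)
    then show ?thesis using s(2) by (simp add: zero_less_mult_iff)
  qed
  then show ?thesis using that s(3) by blast
qed

section \<open>A variational inequality for maps with compact graph\<close>

text \<open>Without a solution, the uniform direction lemma, applied to the compact convex set
  \<open>convex hull M x\<close>, gives each \<open>x\<close> a point \<open>y\<close> with
  \<open>w \<bullet> (y - x) > 0\<close> for all \<open>w \<in> M x\<close>. The map sending
  \<open>x\<close> to all such \<open>y\<close> has a fixed point, which would mean
  \<open>0 > 0\<close>.\<close>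

lemma variational_inequality_compact_graph:
  fixes C :: "'a::euclidean_space set"
  assumes C: "compact C" "convex C" "C \<noteq> {}"
    and graph: "compact {(x, w). x \<in> C \<and> w \<in> M x}"
    and ne: "\<And>x. x \<in> C \<Longrightarrow> M x \<noteq> {}"
  shows "\<exists>x\<in>C. \<exists>w\<in>convex hull M x. \<forall>y\<in>C. w \<bullet> (y - x) \<le> 0"
proof (rule ccontr)
  assume no: "\<not> ?thesis"
  let ?G = "{(x, w). x \<in> C \<and> w \<in> M x}"
  define F where "F x = {y \<in> C. \<forall>w\<in>M x. w \<bullet> (y - x) > 0}" for x
  have comp: "compact (M x)" if "x \<in> C" for x
  proof -
    have "M x = snd ` (?G \<inter> ({x} \<times> UNIV))" using that by force
    moreover have "compact (?G \<inter> ({x} \<times> UNIV))"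
      using graph by (intro compact_Int_closed closed_Times) auto
    ultimately show ?thesis
      by (simp add: compact_continuous_image continuous_on_snd[OF continuous_on_id])
  qed
  have "F x \<noteq> {}" if "x \<in> C" for x
  proof -
    have "\<exists>s\<in>(\<lambda>y. y - x) ` C. w \<bullet> s > 0" if "w \<in> convex hull M x" for w
      using no that \<open>x \<in> C\<close> by (metis image_eqI not_le)
    moreover have "convex ((\<lambda>y. y - x) ` C)" "(\<lambda>y. y - x) ` C \<noteq> {}"
      using C(2,3) by (simp_all add: convex_translation_subtract)
    moreover have "compact (convex hull M x)" "convex hull M x \<noteq> {}"
      using comp[OF that] ne[OF that] by (simp_all add: compact_convex_hull)
    ultimately obtain s where "s \<in> (\<lambda>y. y - x) ` C" "\<And>w. w \<in> convex hull M x \<Longrightarrow> w \<bullet> s > 0"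
      by (metis polar_disjoint_imp_uniform_direction convex_convex_hull)
    then show ?thesis by (auto simp: F_def hull_inc)
  qed
  moreover have "convex (F x)" for x
  proof -
    have "F x = C \<inter> (\<Inter>w\<in>M x. {y. w \<bullet> y > w \<bullet> x})"
      by (auto simp: F_def inner_diff_right)
    then show ?thesis using C(2)
      by (auto intro!: convex_Int convex_INT convex_halfspace_gt)
  qed
  moreover have "openin (top_of_set C) {x \<in> C. y \<in> F x}" if "y \<in> C" for y
  proof -
    \<comment> \<open>The points where \<open>y\<close> fails to be a value of \<open>F\<close> are
      the projection of a closed part of the compact graph, hence a compact set.\<close>
    let ?B = "fst ` (?G \<inter> {p. snd p \<bullet> (y - fst p) \<le> 0})"
    have "compact ?B" using graph
      by (intro compact_continuous_image continuous_intros compact_Int_closed closed_Collect_le)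
    then have "openin (top_of_set C) (C \<inter> - ?B)"
      by (intro openin_open_Int open_Compl compact_imp_closed)
    also have "C \<inter> - ?B = {x \<in> C. y \<in> F x}"
      using that by (force simp: F_def image_iff not_le)
    finally show ?thesis .
  qed
  moreover have "F x \<subseteq> C" for x by (auto simp: F_def)
  ultimately obtain x where x: "x \<in> C" "x \<in> F x"
    using browder_fixed_point[OF C, of F] by blast
  then show False using ne[OF x(1)] by (auto simp: F_def)
qed

section \<open>Projections onto the blocks of the players\<close>

lemma block_linear_simps [simp]:
  "block own i (x + y) = block own i x + block own i y"
  "block own i (x - y) = block own i x - block own i y"
  "block own i (c *\<^sub>R x) = c *\<^sub>R block own i x"
  by (auto simp: block_def vec_eq_iff)

lemma block_in_block_space [simp]: "block own i x \<in> block_space own i"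
  by (simp add: block_def block_space_def)

lemma subspace_block_space: "subspace (block_space own i)"
  by (auto simp: block_space_def subspace_def)

lemma block_eq_self: "x \<in> block_space own i \<Longrightarrow> block own i x = x"
  by (auto simp: block_def block_space_def vec_eq_iff)

lemma sum_blocks:
  fixes own :: "'n::finite \<Rightarrow> 'l::finite"
  shows "(\<Sum>i\<in>UNIV. block own i x) = x"
  by (simp add: vec_eq_iff block_def)

lemma block_inner: "block own i x \<bullet> z = x \<bullet> block own i z"
  unfolding inner_vec_def block_def by (intro sum.cong) auto

lemma inner_block_space: "z \<in> block_space own i \<Longrightarrow> m \<bullet> z = block own i m \<bullet> z"
  by (simp add: block_inner block_eq_self)

lemma norm_le_sum_norm_blocks: "norm x \<le> (\<Sum>i\<in>UNIV. norm (block own i x))"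
  for own :: "'n::finite \<Rightarrow> 'l::finite"
  using norm_sum[of "\<lambda>i. block own i x" UNIV] by (simp add: sum_blocks)


text \<open>As \<open>own\<close> may miss some players, \<open>n_i = 0\<close> is possible; such a
  block contains no unit vector and needs separate treatment.\<close>

lemma block_space_trivial: "i \<notin> range own \<Longrightarrow> block_space own i = {0}"
  by (force simp: block_space_def vec_eq_iff)

section \<open>Unit normals to the preference sets\<close>

text \<open>Normalizing every block, not just \<open>m\<close>, keeps each block non-zero in limits.
  If \<open>P i x\<close> lies in its block space, the inequality for \<open>i\<close> sees only
  block \<open>i\<close> of \<open>m\<close>.\<close>

definition unit_normals ::
    "('n::finite \<Rightarrow> 'l) \<Rightarrow> ('l \<Rightarrow> real ^ 'n \<Rightarrow> (real ^ 'n) set) \<Rightarrow> real ^ 'n \<Rightarrow> (real ^ 'n) set" where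
  "unit_normals own P x =
     {m. (\<forall>i. \<forall>z\<in>P i x. 0 \<le> m \<bullet> (z - block own i x)) \<and> (\<forall>i\<in>range own. norm (block own i m) = 1)}"

lemma norm_unit_normal_le:
  fixes own :: "'n::finite \<Rightarrow> 'l::finite"
  assumes "m \<in> unit_normals own P x"
  shows "norm m \<le> CARD('l)"
proof -
  have "norm (block own i m) \<le> 1" for i
    using assms block_space_trivial[of i own] block_in_block_space[of own i m]
    by (cases "i \<in> range own") (auto simp: unit_normals_def)
  then have "(\<Sum>i\<in>UNIV. norm (block own i m)) \<le> (\<Sum>i::'l\<in>UNIV. 1)"
    by (rule sum_mono)
  then show ?thesis using norm_le_sum_norm_blocks[of m own] by simp
qed

text \<open>The normal is sought in the span of the translated hull, which keeps it inside the block
  space. For empty \<open>Q\<close> any coordinate vector of the block serves.\<close>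

lemma block_separating_unit_vector:
  assumes "Q \<subseteq> block_space own i" "x \<in> block_space own i" "x \<notin> convex hull Q" "i \<in> range own"
  shows "\<exists>m\<in>block_space own i. norm m = 1 \<and> (\<forall>z\<in>Q. 0 \<le> m \<bullet> (z - x))"
proof (cases "Q = {}")
  case True
  obtain j where "own j = i" using assms(4) by blast
  then have "axis j 1 \<in> block_space own i" by (auto simp: block_space_def axis_def)
  then show ?thesis using True by (intro bexI[of _ "axis j 1"]) (auto simp: norm_axis_1)
next
  case False
  let ?S = "(\<lambda>z. z - x) ` (convex hull Q)"
  have "convex ?S" "?S \<noteq> {}" "0 \<notin> ?S"
    using assms(3) False by (auto simp: convex_translation_subtract)
  then obtain a where a: "a \<in> span ?S" "a \<noteq> 0" "\<And>s. s \<in> ?S \<Longrightarrow> 0 \<le> a \<bullet> s"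
    using separating_hyperplane_set_0_inspan by blast
  have "convex hull Q \<subseteq> block_space own i"
    using assms(1) by (simp add: hull_minimal subspace_block_space subspace_imp_convex)
  then have "span ?S \<subseteq> block_space own i"
    using assms(2) by (intro span_minimal subspace_block_space) (auto intro: subspace_diff subspace_block_space)
  then have "a /\<^sub>R norm a \<in> block_space own i"
    using a(1) by (meson subsetD subspace_block_space subspace_scale)
  moreover have "0 \<le> (a /\<^sub>R norm a) \<bullet> (z - x)" if "z \<in> Q" for z
    using a(3)[of "z - x"] that by (simp add: hull_inc)
  moreover have "norm (a /\<^sub>R norm a) = 1" using a(2) by simp
  ultimately show ?thesis by blast
qed

lemma unit_normals_nonempty:
  fixes own :: "'n::finite \<Rightarrow> 'l::finite"
  assumes sub: "\<And>i. P i x \<subseteq> block_space own i"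
    and irrefl: "\<And>i. block own i x \<notin> convex hull (P i x)"
  shows "unit_normals own P x \<noteq> {}"
proof -
  \<comment> \<open>Here \<open>P i x\<close> is contained in \<open>{0}\<close>, and irreflexivity
    excludes \<open>0\<close>, the block of \<open>x\<close>.\<close>
  have empty: "P i x = {}" if "i \<notin> range own" for i
    using sub[of i] irrefl[of i] block_space_trivial[OF that] block_in_block_space[of own i x]
    by (metis hull_inc singletonD subset_singletonD)
  have "\<forall>i. \<exists>m. i \<in> range own \<longrightarrow> m \<in> block_space own i \<and> norm m = 1 \<and>
          (\<forall>z\<in>P i x. 0 \<le> m \<bullet> (z - block own i x))"
    using block_separating_unit_vector[OF sub block_in_block_space irrefl] by blast
  then obtain m where m: "\<And>i. i \<in> range own \<Longrightarrow> m i \<in> block_space own i \<and> norm (m i) = 1 \<and>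
          (\<forall>z\<in>P i x. 0 \<le> m i \<bullet> (z - block own i x))"
    by metis
  \<comment> \<open>Normals chosen separately for the players are glued coordinatewise.\<close>
  define v :: "real ^ 'n" where "v = (\<chi> j. m (own j) $ j)"
  have v: "block own i v = m i" if "i \<in> range own" for i
    using m[OF that] by (auto simp: v_def block_def block_space_def vec_eq_iff)
  have "0 \<le> v \<bullet> (z - block own i x)" if "z \<in> P i x" for i z
  proof -
    have i: "i \<in> range own" using empty that by blast
    have "z - block own i x \<in> block_space own i"
      using sub that by (blast intro: subspace_diff subspace_block_space block_in_block_space)
    from inner_block_space[OF this, of v] show ?thesis using v[OF i] m[OF i] that by simp
  qed
  then have "v \<in> unit_normals own P x" using v m by (auto simp: unit_normals_def)
  then show ?thesis by blast
qed

text \<open>Openness allows moving \<open>z\<close> by \<open>e/2\<close> against block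
  \<open>i\<close> of \<open>m\<close> within \<open>P i x\<close>; the weak inequality at the new
  point leaves a margin of \<open>e/2\<close> at \<open>z\<close>.\<close>

lemma unit_normals_strict:
  assumes m: "m \<in> unit_normals own P x"
    and "openin (top_of_set (block_space own i)) (P i x)"
    and irrefl: "block own i x \<notin> convex hull (P i x)"
    and z: "z \<in> P i x"
  shows "0 < m \<bullet> (z - block own i x)"
proof -
  obtain V where V: "open V" "P i x = block_space own i \<inter> V"
    using assms(2) by (auto simp: openin_open)
  have i: "i \<in> range own"
    using z V(2) irrefl block_space_trivial[of i own] block_in_block_space[of own i x]
    by (metis IntD1 hull_inc singletonD)
  define u where "u = block own i m"
  obtain e where e: "e > 0" "ball z e \<subseteq> V" using V z by (metis IntD2 openE)
  have "z - (e/2) *\<^sub>R u \<in> P i x"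
  proof -
    have "norm u = 1" using m i by (auto simp: unit_normals_def u_def)
    then have "z - (e/2) *\<^sub>R u \<in> ball z e" using e(1) by (simp add: dist_norm)
    moreover have "z - (e/2) *\<^sub>R u \<in> block_space own i"
      using V(2) z unfolding u_def
      by (intro subspace_diff subspace_scale subspace_block_space block_in_block_space) auto
    ultimately show ?thesis using V(2) e(2) by blast
  qed
  then have "0 \<le> m \<bullet> (z - (e/2) *\<^sub>R u - block own i x)"
    using m by (auto simp: unit_normals_def)
  also have "\<dots> = m \<bullet> (z - block own i x) - (e/2) * (m \<bullet> u)"
    by (simp add: inner_diff_right)
  also have "m \<bullet> u = norm u ^ 2"
    unfolding u_def by (metis block_in_block_space inner_block_space power2_norm_eq_inner)
  also have "norm u = 1" using m i by (auto simp: unit_normals_def u_def)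
  finally show ?thesis using e(1) by simp
qed

lemma bounded_linear_block: "bounded_linear (block own i)"
  by (simp add: linear_iff flip: linear_conv_bounded_linear)

text \<open>The graph is bounded because all blocks have norm at most 1. It is closed because a
  violation at the limit, witnessed by \<open>z\<close>, is carried by lower semicontinuity to
  points \<open>z'\<close> near \<open>z\<close> along the sequence.\<close>

lemma compact_graph_unit_normals:
  fixes own :: "'n::finite \<Rightarrow> 'l::finite"
  assumes C: "compact C" "C \<subseteq> X"
    and lsc: "\<And>i. lower_semicontinuous_map_on X (P i)"
  shows "compact {(x, m). x \<in> C \<and> m \<in> unit_normals own P x}" (is "compact ?G")
proof -
  have "closed ?G"
    unfolding closed_sequential_limits
  proof (intro allI impI, elim conjE)
    fix p l assume p: "\<forall>n. p n \<in> ?G" and lim: "p \<longlonglongrightarrow> l"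
    obtain x m where l: "l = (x, m)" by force
    have limx: "(\<lambda>n. fst (p n)) \<longlonglongrightarrow> x" and limm: "(\<lambda>n. snd (p n)) \<longlonglongrightarrow> m"
      using tendsto_fst[OF lim] tendsto_snd[OF lim] l by auto
    have "x \<in> C"
      using limx p compact_imp_closed[OF C(1)] unfolding closed_sequential_limits
      by (metis (no_types, lifting) case_prod_unfold mem_Collect_eq)
    have unit: "norm (block own i m) = 1" if "i \<in> range own" for i
    proof -
      have "(\<lambda>n. norm (block own i (snd (p n)))) \<longlonglongrightarrow> norm (block own i m)"
        by (intro tendsto_norm bounded_linear.tendsto[OF bounded_linear_block] limm)
      moreover have "(\<lambda>n. norm (block own i (snd (p n)))) = (\<lambda>n. 1)"
        using p that by (force simp: unit_normals_def case_prod_unfold)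
      ultimately show ?thesis by (simp add: LIMSEQ_const_iff)
    qed
    have "0 \<le> m \<bullet> (z - block own i x)" if z: "z \<in> P i x" for i z
    proof (rule ccontr)
      assume neg: "\<not> ?thesis"
      \<comment> \<open>Violation is an open condition jointly in \<open>z\<close>, \<open>x\<close>
        and \<open>m\<close>, so it holds on a product neighbourhood
        \<open>V \<times> W\<close>.\<close>
      let ?O = "{q. snd (snd q) \<bullet> (fst q - block own i (fst (snd q))) < 0}"
      have "open ?O"
        by (intro open_Collect_less continuous_intros
              bounded_linear.continuous_on[OF bounded_linear_block])
      moreover have "(z, x, m) \<in> ?O" using neg by simp
      ultimately obtain V W where "open V" "open W" "(z, x, m) \<in> V \<times> W" "V \<times> W \<subseteq> ?O"
        by (rule open_prod_elim)
      then have VW: "open V" "open W" "z \<in> V" "(x, m) \<in> W" "V \<times> W \<subseteq> ?O"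
        by (simp_all only: mem_Sigma_iff)
      obtain U where U: "open U" "x \<in> U" "\<And>y. y \<in> U \<inter> X \<Longrightarrow> P i y \<inter> V \<noteq> {}"
      proof -
        have "x \<in> X" "P i x \<inter> V \<noteq> {}" using \<open>x \<in> C\<close> C(2) VW(3) z by auto
        then show ?thesis
          using lsc[of i] VW(1) that unfolding lower_semicontinuous_map_on_def by meson
      qed
      have "\<forall>\<^sub>F n in sequentially. fst (p n) \<in> U \<and> p n \<in> W"
        using topological_tendstoD[OF limx U(1,2)] topological_tendstoD[OF lim VW(2)] VW(4) l
        by (intro eventually_conj) simp_all
      then obtain n where n: "fst (p n) \<in> U" "p n \<in> W"
        by (auto simp: eventually_sequentially)
      have pn: "fst (p n) \<in> C" "snd (p n) \<in> unit_normals own P (fst (p n))"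
        using spec[OF p, of n] by (simp_all add: case_prod_unfold)
      then obtain z' where z': "z' \<in> P i (fst (p n))" "z' \<in> V"
        using U(3)[of "fst (p n)"] n(1) C(2) by blast
      have "(z', p n) \<in> ?O" using z'(2) n(2) VW(5) by blast
      then have "snd (p n) \<bullet> (z' - block own i (fst (p n))) < 0" by simp
      moreover have "0 \<le> snd (p n) \<bullet> (z' - block own i (fst (p n)))"
        using pn(2) z'(1) unfolding unit_normals_def by simp
      ultimately show False by simp
    qed
    then show "l \<in> ?G" using \<open>x \<in> C\<close> unit l by (auto simp: unit_normals_def)
  qed
  moreover have "?G \<subseteq> C \<times> cball 0 (CARD('l))"
    using norm_unit_normal_le by force
  ultimately show ?thesis
    using compact_Int_closed[OF compact_Times[OF C(1) compact_cball], of ?G 0 "real CARD('l)"]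
    by (simp add: inf.absorb2)
qed

section \<open>Existence of an equilibrium\<close>

theorem theorem3p2:
  fixes own :: "'n::finite \<Rightarrow> 'l::finite"
    and \<X> :: "(real ^ 'n) set"
    and P :: "'l \<Rightarrow> real ^ 'n \<Rightarrow> (real ^ 'n) set"
    and \<rho> :: real
  defines "X \<equiv> strategy_profiles own \<X>"
  assumes "\<X> \<noteq> {}" "closed \<X>" "convex \<X>"
    and P_values: "\<And>i x. x \<in> X \<Longrightarrow> P i x \<subseteq> strategy_set own \<X> i"
    and a_lsc: "\<And>i. lower_semicontinuous_map_on X (P i)"
    and a_open: "\<And>i. open_upper_sections_on (block_space own i) X (P i)"
    and a_irrefl: "\<And>i x. x \<in> X \<Longrightarrow> block own i x \<notin> convex hull (P i x)"
    and b_pos: "\<rho> > 0"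
    and b: "\<And>x. x \<in> \<X> - cball 0 \<rho> \<Longrightarrow>
              \<exists>z\<in>\<X>. norm z < norm x \<and> (\<forall>i. block own i z \<in> P i x)"
    and c: "\<exists>\<rho>'>\<rho>. \<X> \<inter> cball 0 \<rho>' \<noteq> {}"
  shows "\<exists>x. is_equilibrium own \<X> (constraint_map own \<X>) P x"
proof -
  obtain R where R: "R > \<rho>" "\<X> \<inter> cball 0 R \<noteq> {}" using c by blast
  define C where "C = \<X> \<inter> cball 0 R"
  have C: "compact C" "convex C" "C \<noteq> {}"
    using R(2) \<open>closed \<X>\<close> \<open>convex \<X>\<close>
    by (auto simp: C_def closed_Int_compact convex_Int)
  have "\<X> \<subseteq> X" by (auto simp: X_def strategy_profiles_def strategy_set_def)
  then have "C \<subseteq> X" by (auto simp: C_def)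
  have P_block: "P i x \<subseteq> block_space own i" if "x \<in> X" for i x
    using P_values[OF that] by (fastforce simp: strategy_set_def)
  have "\<exists>x\<in>C. \<exists>w\<in>convex hull unit_normals own P x. \<forall>y\<in>C. w \<bullet> (y - x) \<le> 0"
  proof (rule variational_inequality_compact_graph[OF C])
    show "compact {(x, w). x \<in> C \<and> w \<in> unit_normals own P x}"
      by (rule compact_graph_unit_normals[OF C(1) \<open>C \<subseteq> X\<close> a_lsc])
    show "unit_normals own P x \<noteq> {}" if "x \<in> C" for x
      using that \<open>C \<subseteq> X\<close> by (intro unit_normals_nonempty P_block a_irrefl) auto
  qed
  then obtain x w where "x \<in> C" and w: "w \<in> convex hull unit_normals own P x"
    and vi: "\<And>y. y \<in> C \<Longrightarrow> w \<bullet> (y - x) \<le> 0" by blast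
  have x: "x \<in> \<X>" "norm x \<le> R" "x \<in> X"
    using \<open>x \<in> C\<close> \<open>C \<subseteq> X\<close> by (auto simp: C_def)
  have strict: "0 < w \<bullet> (z - block own i x)" if "z \<in> P i x" for i z
  proof -
    have "openin (top_of_set (block_space own i)) (P i x)"
      using a_open x(3) by (auto simp: open_upper_sections_on_def)
    then have "0 < m \<bullet> (z - block own i x)" if "m \<in> unit_normals own P x" for m
      using that a_irrefl[OF x(3)] \<open>z \<in> P i x\<close> by (intro unit_normals_strict)
    \<comment> \<open>For fixed \<open>z\<close> the strict inequality defines a half-space, which
      is convex and so contains the hull with \<open>w\<close>.\<close>
    then have "unit_normals own P x \<subseteq> {m. (z - block own i x) \<bullet> m > 0}"
      by (auto simp: inner_commute)
    then have "convex hull unit_normals own P x \<subseteq> {m. (z - block own i x) \<bullet> m > 0}"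
      by (intro hull_minimal convex_halfspace_gt)
    then show ?thesis using w by (auto simp: inner_commute)
  qed
  have "norm x < R"
  proof (rule ccontr)
    assume "\<not> norm x < R"
    then have "x \<in> \<X> - cball 0 \<rho>" using R(1) x(1) by auto
    then obtain z where z: "z \<in> \<X>" "norm z < norm x" "\<And>i. block own i z \<in> P i x"
      using b by blast
    have "0 < (\<Sum>i\<in>UNIV. w \<bullet> block own i (z - x))"
      using strict[OF z(3)] by (intro sum_pos) auto
    also have "\<dots> = w \<bullet> (z - x)"
      by (simp only: inner_sum_right[symmetric] sum_blocks)
    finally show False using vi[of z] z(1,2) x(2) by (auto simp: C_def)
  qed
  have vi_all: "w \<bullet> (y - x) \<le> 0" if "y \<in> \<X>" for y
  proof -
    \<comment> \<open>The step is short enough to stay in the ball of radius \<open>R\<close>; the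
      minimum with 1 keeps it on the segment, and the \<open>+ 1\<close> avoids a zero denominator
      at \<open>y = x\<close>.\<close>
    define t where "t = min 1 ((R - norm x) / (norm (y - x) + 1))"
    have t: "0 < t" "t \<le> 1" using \<open>norm x < R\<close> by (auto simp: t_def add_nonneg_pos)
    have "t * norm (y - x) \<le> (R - norm x) / (norm (y - x) + 1) * norm (y - x)"
      by (intro mult_right_mono) (auto simp: t_def)
    also have "\<dots> \<le> R - norm x"
      using \<open>norm x < R\<close> by (simp add: divide_le_eq add_nonneg_pos mult_left_mono)
    finally have "norm (x + t *\<^sub>R (y - x)) \<le> R"
      using norm_triangle_ineq[of x "t *\<^sub>R (y - x)"] t by simp
    moreover have "x + t *\<^sub>R (y - x) \<in> \<X>"
      using convexD_alt[OF \<open>convex \<X>\<close> x(1) that, of t] t by (simp add: algebra_simps)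
    ultimately have "t * (w \<bullet> (y - x)) \<le> 0"
      using vi[of "x + t *\<^sub>R (y - x)"] by (simp add: C_def)
    then show ?thesis using t(1) by (simp add: mult_le_0_iff)
  qed
  have "P i x \<inter> constraint_map own \<X> i x = {}" for i
  proof (rule ccontr)
    assume "\<not> ?thesis"
    then obtain z where z: "z \<in> P i x" "replace_block own i x z \<in> \<X>"
      by (auto simp: constraint_map_def)
    \<comment> \<open>Since \<open>z\<close> vanishes outside block \<open>i\<close>, the unilateral
      deviation moves \<open>x\<close> by exactly the vector on which \<open>w\<close> is strictly
      positive.\<close>
    have "replace_block own i x z - x = z - block own i x"
      using P_block[OF x(3), of i] z(1)
      by (auto simp: replace_block_def block_def block_space_def vec_eq_iff)
    then show False using vi_all[OF z(2)] strict[OF z(1)] by simp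
  qed
  moreover have "replace_block own i x (block own i x) = x" for i
    by (simp add: replace_block_def block_def vec_eq_iff)
  then have "block own i x \<in> constraint_map own \<X> i x" for i
    using x(1) by (auto simp: constraint_map_def strategy_set_def)
  ultimately show ?thesis using x(3) unfolding is_equilibrium_def X_def by blast
qed

end
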